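(* Let $\mathbb{K}$ be a field and let $\Delta$ be a $\mathbb{K}$-spherical complex. (1) $\Delta$ is acyclic if and only if $\operatorname{sign}(\Delta)=1$. (2) If $\operatorname{sign}(\Delta)=-1$, then $\Delta$ has the homology of a $(\operatorname{depth}(\mathcal{F})-1)$-dimensional sphere, where $\mathcal{F}$ is any maximal filtration of $\Delta$; in particular $\operatorname{depth}(\mathcal{F})$ is an invariant of $\Delta$ (it does not depend on the choice of maximal filtration $\mathcal F$).
   Context: All simplicial complexes are finite; a vertex of $\Delta$ is an element $v$ with $\{v\}\in\Delta$. The complex $\{\emptyset\}$ has the homology of a $(-1)$-sphere ($\tilde H_{-1}\cong\mathbb{K}$); the void complex $\{\}$ has zero homology. "Having the homology of a $k$-dimensional sphere" ($k\ge-1$) means $\tilde H_k\cong\mathbb{K}$ and $\tilde H_j=0$ for $j\neq k$, coefficients in $\mathbb{K}$; acyclic means all $\tilde H_j(\,\cdot\,;\mathbb{K})=0$. For a vertex $v$ of $\Delta$, $\mathrm{del}_\Delta(v)=\{\sigma\in\Delta: v\notin\sigma\}$ and $\mathrm{link}_\Delta(v)=\{\sigma\in\mathrm{del}_\Delta(v):\sigma\cup\{v\}\in\Delta\}$; if $w$ is not a vertex of $\Delta$, set $\mathrm{del}_\Delta(w)=\Delta$ and $\mathrm{link}_\Delta(w)=\{\}$. $\Delta$ is $\mathbb{K}$-spherical if (recursively) (i) $\tilde H_i(\Delta;\mathbb{K})$ is one-dimensional for at most one $i$ and zero for all other $i$; and (ii) for every vertex $v$ of $\Delta$ both $\mathrm{link}_\Delta(v)$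 and $\mathrm{del}_\Delta(v)$ are $\mathbb{K}$-spherical. For disjoint vertex sets $X,Y$, $\Delta(X\mid Y)$ is the complex obtained from $\Delta$ by successively (in any order) taking the link of each vertex of $X$ and the deletion of each vertex of $Y$. Put $d(X\mid Y)=k$ if $\tilde H_k(\Delta(X\mid Y);\mathbb{K})\cong\mathbb{K}$ for some $k$, and $d(X\mid Y)=\ast$ (a symbol) otherwise. Sign: for a set $B$ of vertices of $\Delta$, let $j_B$ be the number of pairs $(C\mid D)$ with $C\cup D=B$, $C\cap D=\emptyset$ and $d(C\mid D)\ne\ast$. The number $(-1)^{j_B}$ is independent of $B$, and $\operatorname{sign}(\Delta)$ denotes this common value. A filtration $\mathcal F$ of a non-acyclic $\mathbb{K}$-spherical complex $\Delta$ is a sequence $\Delta=\Delta_1\supseteq\Delta_2\supseteq\dots\supseteq\Delta_q$ together with vertices $v_i$ of $\Delta_i$ ($1\le i\le q-1$) such that $\Delta_{i+1}\in\{\mathrm{del}_{\Delta_i}(v_i),\mathrm{link}_{\Delta_i}(v_i)\}$ and each $\Delta_{i+1}$ has the homology of a sphere over $\mathbb{K}$. It is maximal if $\Delta_q=\{\emptyset\}$. Its depth is $\operatorname{depth}(\mathcal F)=|\{v_i:\Delta_{i+1}=\mathrm{link}_{\Delta_i}(v_i)\}|$. *)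

theory Defs
  imports Main
begin

section \<open>Finite simplicial complexes, links and deletions\<close>

text \<open>Both the void complex \<open>{}\<close> and the complex \<open>{{}}\<close> are allowed.\<close>

definition simplicial_complex :: "'a set set \<Rightarrow> bool" where
  "simplicial_complex \<Delta> \<longleftrightarrow>
     finite \<Delta> \<and> (\<forall>\<sigma>\<in>\<Delta>. finite \<sigma>) \<and> (\<forall>\<sigma>\<in>\<Delta>. \<forall>\<tau>. \<tau> \<subseteq> \<sigma> \<longrightarrow> \<tau> \<in> \<Delta>)"

definition vertices :: "'a set set \<Rightarrow> 'a set" where
  "vertices \<Delta> = {v. {v} \<in> \<Delta>}"

definition deletion :: "'a set set \<Rightarrow> 'a \<Rightarrow> 'a set set" where
  "deletion \<Delta> v = {\<sigma> \<in> \<Delta>. v \<notin> \<sigma>}"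

definition link :: "'a set set \<Rightarrow> 'a \<Rightarrow> 'a set set" where
  "link \<Delta> v = {\<sigma> \<in> deletion \<Delta> v. \<sigma> \<union> {v} \<in> \<Delta>}"

text \<open>The conventions for non-vertices hold automatically.\<close>

lemma non_vertex:
  assumes "simplicial_complex \<Delta>" "w \<notin> vertices \<Delta>"
  shows "deletion \<Delta> w = \<Delta>" "link \<Delta> w = {}"
proof -
  have "w \<notin> \<sigma>" if "\<sigma> \<in> \<Delta>" for \<sigma>
    using assms that unfolding simplicial_complex_def vertices_def by blast
  then show "deletion \<Delta> w = \<Delta>" "link \<Delta> w = {}"
    unfolding deletion_def link_def by blast+
qed

text \<open>\<open>minor \<Delta> X Y\<close> is $\Delta(X\mid Y)$. The lemmas below show that the order in which
  the links and deletions are taken is immaterial.\<close>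

definition minor :: "'a set set \<Rightarrow> 'a set \<Rightarrow> 'a set \<Rightarrow> 'a set set" where
  "minor \<Delta> X Y =
     Finite_Set.fold (\<lambda>v \<Gamma>. deletion \<Gamma> v) (Finite_Set.fold (\<lambda>v \<Gamma>. link \<Gamma> v) \<Delta> X) Y"

lemma link_link: "link (link \<Delta> v) w = link (link \<Delta> w) v"
  unfolding link_def deletion_def by (auto simp: insert_commute)

lemma deletion_deletion: "deletion (deletion \<Delta> v) w = deletion (deletion \<Delta> w) v"
  unfolding deletion_def by auto

lemma link_deletion: "v \<noteq> w \<Longrightarrow> link (deletion \<Delta> v) w = deletion (link \<Delta> w) v"
  unfolding link_def deletion_def by auto

lemma comp_fun_commute_link: "comp_fun_commute (\<lambda>v \<Gamma>. link \<Gamma> v)"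
  by standard (auto simp: fun_eq_iff link_link)

lemma comp_fun_commute_deletion: "comp_fun_commute (\<lambda>v \<Gamma>. deletion \<Gamma> v)"
  by standard (auto simp: fun_eq_iff deletion_deletion)


section \<open>Reduced simplicial homology over a field\<close>

text \<open>Simplices are oriented by one fixed linear order on the vertex type.\<close>

definition vertex_order :: "'a rel" where
  "vertex_order = (SOME r. linear_order r)"

lemma linear_order_vertex_order: "linear_order (vertex_order :: 'a rel)"
proof -
  obtain r :: "'a rel" where "well_order_on UNIV r"
    using well_order_on by blast
  then have "linear_order r"
    by (simp add: well_order_on_def)
  then show ?thesis
    unfolding vertex_order_def by (rule someI)
qed

text \<open>The number of elements of \<open>\<tau>\<close> preceding \<open>v\<close>, i.e. the position (from 0) of \<open>v\<close>
  in \<open>\<tau> \<union> {v}\<close>.\<close>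

definition vertex_pos :: "'a \<Rightarrow> 'a set \<Rightarrow> nat" where
  "vertex_pos v \<tau> = card {w \<in> \<tau>. w \<noteq> v \<and> (w, v) \<in> vertex_order}"

text \<open>Degrees are integers; the empty face has degree \<open>-1\<close>, which makes the homology reduced.\<close>

definition chain_space :: "'a set set \<Rightarrow> int \<Rightarrow> ('a set \<Rightarrow> 'k::field) set" where
  "chain_space \<Delta> k = {c. \<forall>\<sigma>. c \<sigma> \<noteq> 0 \<longrightarrow> \<sigma> \<in> \<Delta> \<and> int (card \<sigma>) = k + 1}"

text \<open>The linear extension of
  $\partial[v_0,\dots,v_k] = \sum_i (-1)^i [v_0,\dots,\hat{v_i},\dots,v_k]$, written as the
  coefficient at a face \<open>\<tau>\<close>.\<close>

definition boundary_map :: "'a set set \<Rightarrow> ('a set \<Rightarrow> 'k::field) \<Rightarrow> 'a set \<Rightarrow> 'k" where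
  "boundary_map \<Delta> c \<tau> =
     (\<Sum>v | v \<notin> \<tau> \<and> \<tau> \<union> {v} \<in> \<Delta>. (- 1) ^ vertex_pos v \<tau> * c (\<tau> \<union> {v}))"

definition cycles :: "'a set set \<Rightarrow> int \<Rightarrow> ('a set \<Rightarrow> 'k::field) set" where
  "cycles \<Delta> k = {c \<in> chain_space \<Delta> k. boundary_map \<Delta> c = (\<lambda>_. 0)}"

definition boundaries :: "'a set set \<Rightarrow> int \<Rightarrow> ('a set \<Rightarrow> 'k::field) set" where
  "boundaries \<Delta> k = boundary_map \<Delta> ` chain_space \<Delta> (k + 1)"

definition homologous :: "'a set set \<Rightarrow> int \<Rightarrow> ('a set \<Rightarrow> 'k::field) rel" where
  "homologous \<Delta> k =
     {(z, w). z \<in> cycles \<Delta> k \<and> w \<in> cycles \<Delta> k \<and> (\<lambda>\<sigma>. z \<sigma> - w \<sigma>) \<in> boundaries \<Delta> k}"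

definition homology_class ::
  "'a set set \<Rightarrow> int \<Rightarrow> ('a set \<Rightarrow> 'k::field) \<Rightarrow> ('a set \<Rightarrow> 'k) set" where
  "homology_class \<Delta> k z = homologous \<Delta> k `` {z}"

definition reduced_homology :: "'a set set \<Rightarrow> int \<Rightarrow> ('a set \<Rightarrow> 'k::field) set set" where
  "reduced_homology \<Delta> k = cycles \<Delta> k // homologous \<Delta> k"

text \<open>In the following the coefficient field is passed as a type argument.\<close>

definition homology_zero :: "'k::field itself \<Rightarrow> 'a set set \<Rightarrow> int \<Rightarrow> bool" where
  "homology_zero K \<Delta> k \<longleftrightarrow>
     (reduced_homology \<Delta> k :: ('a set \<Rightarrow> 'k) set set) = {homology_class \<Delta> k (\<lambda>_. 0)}"

text \<open>There is a \<open>'k\<close>-linear isomorphism from the \<open>k\<close>-th reduced homology onto \<open>'k\<close>; the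
  vector space operations on homology classes are those induced by cycles.\<close>

definition homology_line :: "'k::field itself \<Rightarrow> 'a set set \<Rightarrow> int \<Rightarrow> bool" where
  "homology_line K \<Delta> k \<longleftrightarrow>
     (\<exists>\<phi> :: ('a set \<Rightarrow> 'k) set \<Rightarrow> 'k.
        bij_betw \<phi> (reduced_homology \<Delta> k) UNIV \<and>
        (\<forall>z\<in>cycles \<Delta> k. \<forall>w\<in>cycles \<Delta> k.
           \<phi> (homology_class \<Delta> k (\<lambda>\<sigma>. z \<sigma> + w \<sigma>)) =
             \<phi> (homology_class \<Delta> k z) + \<phi> (homology_class \<Delta> k w)) \<and>
        (\<forall>a. \<forall>z\<in>cycles \<Delta> k.
           \<phi> (homology_class \<Delta> k (\<lambda>\<sigma>. a * z \<sigma>)) = a * \<phi> (homology_class \<Delta> k z)))"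

definition acyclic_complex :: "'k::field itself \<Rightarrow> 'a set set \<Rightarrow> bool" where
  "acyclic_complex K \<Delta> \<longleftrightarrow> (\<forall>j. homology_zero K \<Delta> j)"

definition sphere_homology :: "'k::field itself \<Rightarrow> int \<Rightarrow> 'a set set \<Rightarrow> bool" where
  "sphere_homology K k \<Delta> \<longleftrightarrow>
     k \<ge> -1 \<and> homology_line K \<Delta> k \<and> (\<forall>j. j \<noteq> k \<longrightarrow> homology_zero K \<Delta> j)"


section \<open>Spherical complexes, their sign and filtrations\<close>

inductive spherical :: "'k::field itself \<Rightarrow> 'a set set \<Rightarrow> bool" for K where
  "\<lbrakk> simplicial_complex \<Delta>;
     \<forall>i. homology_zero K \<Delta> i \<or> homology_line K \<Delta> i;
     \<forall>i j. homology_line K \<Delta> i \<longrightarrow> homology_line K \<Delta> j \<longrightarrow> i = j;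
     \<forall>v\<in>vertices \<Delta>. spherical K (link \<Delta> v) \<and> spherical K (deletion \<Delta> v) \<rbrakk>
   \<Longrightarrow> spherical K \<Delta>"

text \<open>\<open>None\<close> plays the role of the symbol $\ast$. For spherical \<open>\<Delta>\<close> the degree \<open>k\<close> is
  unique.\<close>

definition homology_degree :: "'k::field itself \<Rightarrow> 'a set set \<Rightarrow> 'a set \<Rightarrow> 'a set \<Rightarrow> int option"
  where
  "homology_degree K \<Delta> X Y =
     (if \<exists>k. homology_line K (minor \<Delta> X Y) k
      then Some (SOME k. homology_line K (minor \<Delta> X Y) k) else None)"

definition nonacyclic_count :: "'k::field itself \<Rightarrow> 'a set set \<Rightarrow> 'a set \<Rightarrow> nat" where
  "nonacyclic_count K \<Delta> B =
     card {(C, D). C \<union> D = B \<and> C \<inter> D = {} \<and> homology_degree K \<Delta> C D \<noteq> None}"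

text \<open>The common value of $(-1)^{j_B}$ over all sets \<open>B\<close> of vertices.\<close>

definition complex_sign :: "'k::field itself \<Rightarrow> 'a set set \<Rightarrow> int" where
  "complex_sign K \<Delta> = (THE s. \<forall>B\<subseteq>vertices \<Delta>. (- 1) ^ nonacyclic_count K \<Delta> B = s)"

text \<open>A filtration is given by the list \<open>Ds\<close> of its $q$ complexes and the list \<open>vs\<close> of its
  $q-1$ vertices.\<close>

definition filtration ::
  "'k::field itself \<Rightarrow> 'a set set \<Rightarrow> 'a set set list \<Rightarrow> 'a list \<Rightarrow> bool" where
  "filtration K \<Delta> Ds vs \<longleftrightarrow>
     length Ds = length vs + 1 \<and> Ds ! 0 = \<Delta> \<and>
     (\<forall>i<length vs.
        Ds ! (i + 1) \<subseteq> Ds ! i \<and>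
        vs ! i \<in> vertices (Ds ! i) \<and>
        Ds ! (i + 1) \<in> {deletion (Ds ! i) (vs ! i), link (Ds ! i) (vs ! i)} \<and>
        (\<exists>k. sphere_homology K k (Ds ! (i + 1))))"

definition maximal_filtration ::
  "'k::field itself \<Rightarrow> 'a set set \<Rightarrow> 'a set set list \<Rightarrow> 'a list \<Rightarrow> bool" where
  "maximal_filtration K \<Delta> Ds vs \<longleftrightarrow> filtration K \<Delta> Ds vs \<and> last Ds = {{}}"

definition filtration_depth :: "'a set set list \<Rightarrow> 'a list \<Rightarrow> nat" where
  "filtration_depth Ds vs =
     card {vs ! i | i. i < length vs \<and> Ds ! (i + 1) = link (Ds ! i) (vs ! i)}"

end

theory Submission
  imports Defs
begin

text \<open>
  Fix a vertex \<open>v\<close> of a spherical complex \<open>\<Delta>\<close>. A chain on \<open>\<Delta>\<close> is a pair of a chain on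
  \<open>deletion \<Delta> v\<close> (its coefficients on faces avoiding \<open>v\<close>) and a chain on \<open>link \<Delta> v\<close> (its
  coefficients on faces containing \<open>v\<close>, up to sign). In these terms the boundary is
  $\partial(d, l) = (\partial d + l, -\partial l)$: the chain complex of \<open>\<Delta>\<close> is the mapping cone
  of the inclusion of the link into the deletion. Hence there is a long exact sequence
  \[\cdots \to \tilde H_k(\mathrm{link}) \to \tilde H_k(\mathrm{del}) \to \tilde H_k(\Delta)
    \to \tilde H_{k-1}(\mathrm{link}) \to \cdots.\]

  The total homology of each of the three complexes has dimension 0 or 1. Three such spaces in an
  exact triangle have an even total dimension, so an even number of the three complexes is
  non-acyclic (\<open>non_acyclic_parity\<close>). With the value \<open>-1\<close> for non-acyclic and \<open>1\<close> for acyclic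
  spherical complexes this says that the value of \<open>\<Delta>\<close> is the product of the values of its
  deletion and its link. Adding a vertex to \<open>B\<close> splits every minor \<open>minor \<Delta> C D\<close> with
  $C \sqcup D = B$ into its deletion and its link, so the product of the values over all these
  minors, which is $(-1)^{j_B}$, does not change; for $B = \emptyset$ it is the value of \<open>\<Delta>\<close>.
  Thus the sign of \<open>\<Delta>\<close> is \<open>-1\<close> exactly if \<open>\<Delta>\<close> is not acyclic (\<open>complex_sign_eq\<close>).

  If \<open>\<Delta>\<close> is not acyclic, then by the same parity exactly one of link and deletion is not acyclic,
  and following it until no vertex is left gives a maximal filtration
  (\<open>maximal_filtration_exists\<close>). Since the other one is acyclic, the exact sequence shows that
  passing to the deletion keeps the degree of the homology, whereas passing to the link lowers it
  by one. A maximal filtration ends in \<open>{{}}\<close>, whose homology is in degree \<open>-1\<close>, so the degree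
  for \<open>\<Delta>\<close> is the number of links minus one (\<open>homology_line_filtration_depth\<close>). As this degree
  is unique, the depth is the same for all maximal filtrations.
\<close>

section \<open>Chains, boundaries and cycles\<close>

definition supported_on :: "'a set set \<Rightarrow> ('a set \<Rightarrow> 'k::field) \<Rightarrow> bool" where
  "supported_on \<Delta> c \<longleftrightarrow> (\<forall>\<sigma>. c \<sigma> \<noteq> 0 \<longrightarrow> \<sigma> \<in> \<Delta>)"

lemma chain_space_supported: "c \<in> chain_space \<Delta> k \<Longrightarrow> supported_on \<Delta> c"
  by (auto simp: chain_space_def supported_on_def)

lemma simplicial_finite_Union: "simplicial_complex \<Delta> \<Longrightarrow> finite (\<Union>\<Delta>)"
  by (auto simp: simplicial_complex_def)

lemma simplicial_subset: "simplicial_complex \<Delta> \<Longrightarrow> \<sigma> \<in> \<Delta> \<Longrightarrow> \<tau> \<subseteq> \<sigma> \<Longrightarrow> \<tau> \<in> \<Delta>"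
  unfolding simplicial_complex_def by blast

text \<open>Summing over a fixed finite set of vertices removes the dependence of the index set on
  \<open>\<Delta>\<close> and \<open>\<tau>\<close>, so that boundaries taken in different complexes can be compared termwise.\<close>

lemma boundary_map_alt:
  assumes "finite V" "\<Union>\<Delta> \<subseteq> V" "supported_on \<Delta> c"
  shows "boundary_map \<Delta> c \<tau> = (\<Sum>w\<in>V - \<tau>. (-1) ^ vertex_pos w \<tau> * c (insert w \<tau>))"
proof -
  have "{w. w \<notin> \<tau> \<and> \<tau> \<union> {w} \<in> \<Delta>} \<subseteq> V - \<tau>"
    using assms(2) by blast
  moreover have "c (insert w \<tau>) = 0" if "insert w \<tau> \<notin> \<Delta>" for w
    using assms(3) that by (auto simp: supported_on_def)
  ultimately show ?thesis
    unfolding boundary_map_def using assms(1)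
    by (intro sum.mono_neutral_cong_left) auto
qed

lemma boundary_map_subcomplex:
  assumes "simplicial_complex \<Delta>" "\<Gamma> \<subseteq> \<Delta>" "supported_on \<Gamma> c"
  shows "boundary_map \<Gamma> c = boundary_map \<Delta> c"
proof
  fix \<tau>
  have "supported_on \<Delta> c"
    using assms by (auto simp: supported_on_def)
  then show "boundary_map \<Gamma> c \<tau> = boundary_map \<Delta> c \<tau>"
    using boundary_map_alt[of "\<Union>\<Delta>" \<Gamma> c \<tau>] boundary_map_alt[of "\<Union>\<Delta>" \<Delta> c \<tau>]
      assms simplicial_finite_Union by (metis Union_mono order_refl)
qed

lemma boundary_map_combination:
  "boundary_map \<Delta> (\<lambda>\<sigma>. a * x \<sigma> + b * y \<sigma>) \<tau> =
     a * boundary_map \<Delta> x \<tau> + b * boundary_map \<Delta> y \<tau>"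
  by (simp add: boundary_map_def sum.distrib sum_distrib_left algebra_simps)

lemma boundary_map_zero: "boundary_map \<Delta> (\<lambda>_. 0) = (\<lambda>_. 0)"
  by (simp add: boundary_map_def fun_eq_iff)

lemma chain_space_combination:
  "x \<in> chain_space \<Delta> k \<Longrightarrow> y \<in> chain_space \<Delta> k \<Longrightarrow>
     (\<lambda>\<sigma>. a * x \<sigma> + b * y \<sigma>) \<in> chain_space \<Delta> k"
  unfolding chain_space_def mem_Collect_eq by (metis add_0 mult_zero_right)

lemma chain_space_zero: "(\<lambda>_. 0) \<in> chain_space \<Delta> k"
  by (simp add: chain_space_def)

lemma cycles_combination:
  assumes "x \<in> cycles \<Delta> k" "y \<in> cycles \<Delta> k" "\<And>\<sigma>. w \<sigma> = a * x \<sigma> + b * y \<sigma>"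
  shows "w \<in> cycles \<Delta> k"
proof -
  have w: "w = (\<lambda>\<sigma>. a * x \<sigma> + b * y \<sigma>)"
    using assms(3) by blast
  show ?thesis
    unfolding w using assms(1,2) chain_space_combination[of x \<Delta> k y a b]
      boundary_map_combination[of \<Delta> a x b y]
    by (simp add: cycles_def fun_eq_iff)
qed

lemma boundaries_combination:
  assumes "x \<in> boundaries \<Delta> k" "y \<in> boundaries \<Delta> k" "\<And>\<sigma>. w \<sigma> = a * x \<sigma> + b * y \<sigma>"
  shows "w \<in> boundaries \<Delta> k"
proof -
  obtain x' y' where x': "x' \<in> chain_space \<Delta> (k + 1)" "x = boundary_map \<Delta> x'"
    and y': "y' \<in> chain_space \<Delta> (k + 1)" "y = boundary_map \<Delta> y'"
    using assms(1,2) by (auto simp: boundaries_def)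
  have "w = boundary_map \<Delta> (\<lambda>\<sigma>. a * x' \<sigma> + b * y' \<sigma>)"
    using assms(3) x'(2) y'(2) boundary_map_combination[of \<Delta> a x' b y'] by (simp add: fun_eq_iff)
  then show ?thesis
    using chain_space_combination[OF x'(1) y'(1)] by (auto simp: boundaries_def)
qed

lemma cycles_zero: "(\<lambda>_. 0) \<in> cycles \<Delta> k"
  by (simp add: cycles_def chain_space_zero boundary_map_zero)

lemma boundaries_zero: "(\<lambda>_. 0) \<in> boundaries \<Delta> k"
  unfolding boundaries_def
  by (rule image_eqI[of _ _ "\<lambda>_. 0"]) (simp_all only: chain_space_zero boundary_map_zero)

lemma boundaries_scale:
  assumes "x \<in> boundaries \<Delta> k" "\<And>\<sigma>. w \<sigma> = a * x \<sigma>"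
  shows "w \<in> boundaries \<Delta> k"
  using boundaries_combination[OF assms(1) boundaries_zero, of w a 0] assms(2) by simp

lemma cycles_subcomplex:
  assumes "simplicial_complex \<Delta>" "\<Gamma> \<subseteq> \<Delta>"
  shows "cycles \<Gamma> k \<subseteq> cycles \<Delta> k"
proof
  fix z assume z: "z \<in> cycles \<Gamma> k"
  then have "supported_on \<Gamma> z"
    by (auto simp: cycles_def intro: chain_space_supported)
  then have "boundary_map \<Gamma> z = boundary_map \<Delta> z"
    by (rule boundary_map_subcomplex[OF assms])
  then show "z \<in> cycles \<Delta> k"
    using z assms(2) by (auto simp: cycles_def chain_space_def)
qed

lemma boundaries_subcomplex:
  assumes "simplicial_complex \<Delta>" "\<Gamma> \<subseteq> \<Delta>"
  shows "boundaries \<Gamma> k \<subseteq> boundaries \<Delta> k"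
proof
  fix b assume "b \<in> boundaries \<Gamma> k"
  then obtain c where c: "c \<in> chain_space \<Gamma> (k + 1)" "b = boundary_map \<Gamma> c"
    by (auto simp: boundaries_def)
  then have "b = boundary_map \<Delta> c"
    using boundary_map_subcomplex[OF assms] chain_space_supported by blast
  moreover have "c \<in> chain_space \<Delta> (k + 1)"
    using c(1) assms(2) by (auto simp: chain_space_def)
  ultimately show "b \<in> boundaries \<Delta> k"
    by (auto simp: boundaries_def)
qed

section \<open>Vanishing and one-dimensional homology in terms of cycles\<close>

lemma homology_class_eqI:
  assumes "z \<in> cycles \<Delta> k" "w \<in> cycles \<Delta> k" "(\<lambda>\<sigma>. z \<sigma> - w \<sigma>) \<in> boundaries \<Delta> k"
  shows "homology_class \<Delta> k z = homology_class \<Delta> k w"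
proof -
  have "(\<lambda>\<sigma>. z \<sigma> - u \<sigma>) \<in> boundaries \<Delta> k \<longleftrightarrow> (\<lambda>\<sigma>. w \<sigma> - u \<sigma>) \<in> boundaries \<Delta> k" for u
  proof
    assume "(\<lambda>\<sigma>. z \<sigma> - u \<sigma>) \<in> boundaries \<Delta> k"
    then show "(\<lambda>\<sigma>. w \<sigma> - u \<sigma>) \<in> boundaries \<Delta> k"
      by (rule boundaries_combination[OF _ assms(3), where a = 1 and b = "-1"]) simp
  next
    assume "(\<lambda>\<sigma>. w \<sigma> - u \<sigma>) \<in> boundaries \<Delta> k"
    then show "(\<lambda>\<sigma>. z \<sigma> - u \<sigma>) \<in> boundaries \<Delta> k"
      by (rule boundaries_combination[OF _ assms(3), where a = 1 and b = 1]) simp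
  qed
  then show ?thesis
    using assms(1,2) by (auto simp: homology_class_def homologous_def)
qed

lemma homology_class_eqD:
  assumes "z \<in> cycles \<Delta> k" "w \<in> cycles \<Delta> k" "homology_class \<Delta> k z = homology_class \<Delta> k w"
  shows "(\<lambda>\<sigma>. z \<sigma> - w \<sigma>) \<in> boundaries \<Delta> k"
proof -
  have "w \<in> homology_class \<Delta> k w"
    using assms(2) boundaries_zero[of \<Delta> k] by (simp add: homology_class_def homologous_def)
  then have "w \<in> homology_class \<Delta> k z"
    using assms(3) by simp
  then show ?thesis
    by (simp add: homology_class_def homologous_def)
qed

lemma reduced_homology_classes: "reduced_homology \<Delta> k = homology_class \<Delta> k ` cycles \<Delta> k"
  by (auto simp: reduced_homology_def quotient_def homology_class_def)

lemma homology_zero_iff: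
  fixes K :: "'k::field itself"
  shows "homology_zero K \<Delta> k \<longleftrightarrow> (cycles \<Delta> k :: ('a set \<Rightarrow> 'k) set) \<subseteq> boundaries \<Delta> k"
proof
  assume "homology_zero K \<Delta> k"
  then have "homology_class \<Delta> k z = homology_class \<Delta> k (\<lambda>_. 0)" if "z \<in> cycles \<Delta> k"
    for z :: "'a set \<Rightarrow> 'k"
    using that unfolding homology_zero_def reduced_homology_classes by blast
  from homology_class_eqD[OF _ cycles_zero this]
  show "(cycles \<Delta> k :: ('a set \<Rightarrow> 'k) set) \<subseteq> boundaries \<Delta> k"
    by auto
next
  assume *: "(cycles \<Delta> k :: ('a set \<Rightarrow> 'k) set) \<subseteq> boundaries \<Delta> k"
  have "homology_class \<Delta> k z = homology_class \<Delta> k (\<lambda>_. 0)" if "z \<in> cycles \<Delta> k"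
    for z :: "'a set \<Rightarrow> 'k"
    using homology_class_eqI[OF that cycles_zero] * that by auto
  then show "homology_zero K \<Delta> k"
    unfolding homology_zero_def reduced_homology_classes using cycles_zero by blast
qed

text \<open>The form in which a one-dimensional homology group enters the diagram chases below:
  a representing cycle in place of an isomorphism on classes.\<close>

lemma homology_line_generator:
  fixes K :: "'k::field itself"
  assumes "homology_line K \<Delta> k"
  obtains g :: "'a set \<Rightarrow> 'k" where "g \<in> cycles \<Delta> k" "g \<notin> boundaries \<Delta> k"
    "\<forall>z\<in>cycles \<Delta> k. \<exists>a. (\<lambda>\<sigma>. z \<sigma> - a * g \<sigma>) \<in> boundaries \<Delta> k"
proof -
  let ?h = "homology_class \<Delta> k :: ('a set \<Rightarrow> 'k) \<Rightarrow> _"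
  obtain \<phi> :: "('a set \<Rightarrow> 'k) set \<Rightarrow> 'k" where
    bij: "bij_betw \<phi> (?h ` cycles \<Delta> k) UNIV"
    and "\<forall>a. \<forall>z\<in>cycles \<Delta> k. \<phi> (?h (\<lambda>\<sigma>. a * z \<sigma>)) = a * \<phi> (?h z)"
    using assms unfolding homology_line_def reduced_homology_classes
    by (elim exE conjE) (rule that)
  then have scale: "\<phi> (?h (\<lambda>\<sigma>. a * z \<sigma>)) = a * \<phi> (?h z)" if "z \<in> cycles \<Delta> k" for a z
    using that by simp
  have "1 \<in> \<phi> ` ?h ` cycles \<Delta> k"
    using bij by (simp add: bij_betw_def)
  then obtain g where g: "g \<in> cycles \<Delta> k" "\<phi> (?h g) = 1"
    by (metis imageE)
  have \<phi>0: "\<phi> (?h (\<lambda>_. 0)) = 0"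
    using scale[OF g(1), of 0] by simp
  show thesis
  proof (rule that, fact g(1))
    show "g \<notin> boundaries \<Delta> k"
      using homology_class_eqI[OF g(1) cycles_zero] g(2) \<phi>0 by auto
    show "\<forall>z\<in>cycles \<Delta> k. \<exists>a. (\<lambda>\<sigma>. z \<sigma> - a * g \<sigma>) \<in> boundaries \<Delta> k"
    proof
      fix z :: "'a set \<Rightarrow> 'k" assume z: "z \<in> cycles \<Delta> k"
      let ?a = "\<phi> (?h z)"
      let ?ag = "\<lambda>\<sigma>. ?a * g \<sigma>"
      have ag: "?ag \<in> cycles \<Delta> k"
        by (rule cycles_combination[OF g(1) g(1), of _ ?a 0]) simp
      have "\<phi> (?h z) = \<phi> (?h ?ag)"
        using scale[OF g(1), of ?a] g(2) by simp
      then have "?h z = ?h ?ag"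
        by (rule inj_onD[OF bij_betw_imp_inj_on[OF bij]]) (rule imageI, fact)+
      from homology_class_eqD[OF z ag this]
      show "\<exists>a. (\<lambda>\<sigma>. z \<sigma> - a * g \<sigma>) \<in> boundaries \<Delta> k"
        by (rule exI[of _ ?a])
    qed
  qed
qed

lemma homology_line_not_zero:
  fixes K :: "'k::field itself"
  assumes "homology_line K \<Delta> k"
  shows "\<not> homology_zero K (\<Delta> :: 'a set set) k"
proof -
  obtain g :: "'a set \<Rightarrow> 'k" where "g \<in> cycles \<Delta> k" "g \<notin> boundaries \<Delta> k"
    by (rule homology_line_generator[OF assms])
  then show ?thesis
    unfolding homology_zero_iff by (meson subsetD)
qed

lemma homology_line_face:
  fixes K :: "'k::field itself"
  assumes "homology_line K \<Delta> k"
  obtains \<sigma> where "\<sigma> \<in> \<Delta>" "int (card \<sigma>) = k + 1"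
proof -
  obtain g :: "'a set \<Rightarrow> 'k" where g: "g \<in> cycles \<Delta> k" "g \<notin> boundaries \<Delta> k"
    by (rule homology_line_generator[OF assms])
  then have "g \<noteq> (\<lambda>_. 0)"
    by (auto simp: boundaries_zero)
  then obtain \<sigma> where "g \<sigma> \<noteq> 0"
    by (auto simp: fun_eq_iff)
  then show thesis
    using g(1) that by (auto simp: cycles_def chain_space_def)
qed

section \<open>The exact sequence of link, deletion and complex\<close>

text \<open>\<open>avoiding_part v\<close> and \<open>slice v\<close> are the two components of a chain in the mapping cone
  description. The sign in \<open>slice\<close> is the one with which \<open>\<sigma>\<close> occurs in the boundary of
  $\sigma \cup \{v\}$, i.e. faces containing \<open>v\<close> are reoriented so that \<open>v\<close> comes first.\<close>

definition slice :: "'a \<Rightarrow> ('a set \<Rightarrow> 'k::field) \<Rightarrow> 'a set \<Rightarrow> 'k" where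
  "slice v c \<sigma> = (if v \<in> \<sigma> then 0 else (-1) ^ vertex_pos v \<sigma> * c (insert v \<sigma>))"

definition avoiding_part :: "'a \<Rightarrow> ('a set \<Rightarrow> 'k::field) \<Rightarrow> 'a set \<Rightarrow> 'k" where
  "avoiding_part v c \<sigma> = (if v \<in> \<sigma> then 0 else c \<sigma>)"

text \<open>The inverse of \<open>slice v\<close> on chains all of whose faces contain \<open>v\<close>.\<close>

definition cone :: "'a \<Rightarrow> ('a set \<Rightarrow> 'k::field) \<Rightarrow> 'a set \<Rightarrow> 'k" where
  "cone v l \<sigma> = (if v \<in> \<sigma> then (-1) ^ vertex_pos v (\<sigma> - {v}) * l (\<sigma> - {v}) else 0)"

lemma chain_ext:
  assumes "avoiding_part v x = avoiding_part v y" "slice v x = slice v y"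
  shows "x = y"
proof
  fix \<sigma>
  show "x \<sigma> = y \<sigma>"
  proof (cases "v \<in> \<sigma>")
    case True
    then show ?thesis
      using fun_cong[OF assms(2), of "\<sigma> - {v}"] by (simp add: slice_def insert_absorb)
  next
    case False
    then show ?thesis
      using fun_cong[OF assms(1), of \<sigma>] by (simp add: avoiding_part_def)
  qed
qed

lemma slice_cone:
  assumes "supported_on (link \<Delta> v) l"
  shows "slice v (cone v l) = l"
proof
  fix \<sigma>
  show "slice v (cone v l) \<sigma> = l \<sigma>"
    using assms by (auto simp: slice_def cone_def supported_on_def link_def deletion_def
        simp flip: mult.assoc power_add)
qed

lemma avoiding_part_cone: "avoiding_part v (cone v l) = (\<lambda>_. 0)"
  by (auto simp: avoiding_part_def cone_def)

lemma avoiding_part_deletion: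
  "supported_on (deletion \<Delta> v) d \<Longrightarrow> avoiding_part v d = d"
  by (auto simp: avoiding_part_def supported_on_def deletion_def fun_eq_iff)

lemma slice_deletion:
  "supported_on (deletion \<Delta> v) d \<Longrightarrow> slice v d = (\<lambda>_. 0)"
  by (auto simp: slice_def supported_on_def deletion_def fun_eq_iff)

lemma slice_combination:
  "slice v (\<lambda>\<sigma>. a * x \<sigma> + b * y \<sigma>) = (\<lambda>\<sigma>. a * slice v x \<sigma> + b * slice v y \<sigma>)"
  by (auto simp: slice_def fun_eq_iff algebra_simps)

lemma avoiding_part_combination:
  "avoiding_part v (\<lambda>\<sigma>. a * x \<sigma> + b * y \<sigma>) =
     (\<lambda>\<sigma>. a * avoiding_part v x \<sigma> + b * avoiding_part v y \<sigma>)"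
  by (auto simp: avoiding_part_def fun_eq_iff)

lemma deletion_subset: "deletion \<Delta> v \<subseteq> \<Delta>"
  by (auto simp: deletion_def)

lemma link_subset_deletion: "link \<Delta> v \<subseteq> deletion \<Delta> v"
  by (auto simp: link_def)

lemma simplicial_deletion: "simplicial_complex \<Delta> \<Longrightarrow> simplicial_complex (deletion \<Delta> v)"
  unfolding simplicial_complex_def deletion_def by auto

lemma chain_space_avoiding_part:
  "c \<in> chain_space \<Delta> k \<Longrightarrow> avoiding_part v c \<in> chain_space (deletion \<Delta> v) k"
  by (auto simp: chain_space_def avoiding_part_def deletion_def)

lemma chain_space_slice:
  assumes "simplicial_complex \<Delta>" "c \<in> chain_space \<Delta> k"
  shows "slice v c \<in> chain_space (link \<Delta> v) (k - 1)"
proof -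
  have "\<sigma> \<in> link \<Delta> v \<and> int (card \<sigma>) = k" if "v \<notin> \<sigma>" "c (insert v \<sigma>) \<noteq> 0" for \<sigma>
  proof -
    have *: "insert v \<sigma> \<in> \<Delta>" "int (card (insert v \<sigma>)) = k + 1"
      using assms(2) that(2) by (auto simp: chain_space_def)
    then have "finite (insert v \<sigma>)"
      using assms(1) unfolding simplicial_complex_def by blast
    then show ?thesis
      using * that(1) simplicial_subset[OF assms(1) *(1), of \<sigma>]
      by (auto simp: link_def deletion_def)
  qed
  then show ?thesis
    by (auto simp: chain_space_def slice_def split: if_splits)
qed

lemma chain_space_cone:
  assumes "simplicial_complex \<Delta>" "l \<in> chain_space (link \<Delta> v) k"
  shows "cone v l \<in> chain_space \<Delta> (k + 1)"
proof -
  have "\<sigma> \<in> \<Delta> \<and> int (card \<sigma>) = k + 2" if "v \<in> \<sigma>" "l (\<sigma> - {v}) \<noteq> 0" for \<sigma>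
  proof -
    have *: "\<sigma> - {v} \<in> link \<Delta> v" "int (card (\<sigma> - {v})) = k + 1"
      using assms(2) that(2) by (auto simp: chain_space_def)
    then have "\<sigma> \<in> \<Delta>"
      using that(1) by (auto simp: link_def insert_absorb)
    moreover have "finite \<sigma>"
      using calculation assms(1) unfolding simplicial_complex_def by blast
    ultimately show ?thesis
      using *(2) card_Suc_Diff1[of \<sigma> v] that(1) by simp
  qed
  then show ?thesis
    by (auto simp: chain_space_def cone_def split: if_splits)
qed

lemma vertex_pos_insert:
  assumes "finite \<tau>" "w \<notin> \<tau>" "w \<noteq> v"
  shows "vertex_pos v (insert w \<tau>) = vertex_pos v \<tau> + (if (w, v) \<in> vertex_order then 1 else 0)"
proof -
  have "{u \<in> insert w \<tau>. u \<noteq> v \<and> (u, v) \<in> vertex_order} =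
      (if (w, v) \<in> vertex_order then insert w else id) {u \<in> \<tau>. u \<noteq> v \<and> (u, v) \<in> vertex_order}"
    using assms by auto
  then show ?thesis
    using assms by (simp add: vertex_pos_def)
qed

lemma vertex_order_total: "v \<noteq> w \<Longrightarrow> (v, w) \<in> vertex_order \<longleftrightarrow> (w, v) \<notin> vertex_order"
  using linear_order_vertex_order
  by (auto simp: linear_order_on_def partial_order_on_def total_on_def antisym_def)

text \<open>Exactly one of \<open>v\<close> and \<open>w\<close> precedes the other, so inserting both in the two possible
  orders changes exactly one of the two positions by one. This is the identity behind
  $\partial \circ \partial = 0$; below it makes \<open>slice\<close> anticommute with the boundary.\<close>

lemma vertex_sign_swap:
  assumes "finite \<tau>" "v \<notin> \<tau>" "w \<notin> \<tau>" "v \<noteq> w"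
  shows "(-1 :: 'k::field) ^ vertex_pos v \<tau> * (-1) ^ vertex_pos w (insert v \<tau>) =
    - ((-1) ^ vertex_pos w \<tau> * (-1) ^ vertex_pos v (insert w \<tau>))"
  using vertex_pos_insert[of \<tau> v w] vertex_pos_insert[of \<tau> w v] vertex_order_total[of v w] assms
  by (auto simp: mult.commute)

text \<open>First component of the mapping cone boundary: a face avoiding \<open>v\<close> receives
  contributions from cofaces that avoid \<open>v\<close>, and from the single coface obtained by adding \<open>v\<close>.\<close>

lemma avoiding_part_boundary:
  assumes "simplicial_complex \<Delta>" "supported_on \<Delta> c"
  shows "avoiding_part v (boundary_map \<Delta> c) \<tau> =
    slice v c \<tau> + boundary_map (deletion \<Delta> v) (avoiding_part v c) \<tau>"
proof (cases "v \<in> \<tau>")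
  case True
  then have "{w. w \<notin> \<tau> \<and> \<tau> \<union> {w} \<in> deletion \<Delta> v} = {}"
    by (auto simp: deletion_def)
  then show ?thesis
    using True unfolding boundary_map_def by (simp add: avoiding_part_def slice_def)
next
  case False
  define V where "V = insert v (\<Union>\<Delta>)"
  have V: "finite V" "\<Union>\<Delta> \<subseteq> V" "\<Union>(deletion \<Delta> v) \<subseteq> V" "v \<in> V - \<tau>"
    using simplicial_finite_Union[OF assms(1)] False by (auto simp: V_def deletion_def)
  have sup: "supported_on (deletion \<Delta> v) (avoiding_part v c)"
    using assms(2) by (auto simp: supported_on_def avoiding_part_def deletion_def)
  let ?f = "\<lambda>c w. (-1) ^ vertex_pos w \<tau> * c (insert w \<tau>)"
  have "boundary_map \<Delta> c \<tau> = ?f c v + (\<Sum>w\<in>V - \<tau> - {v}. ?f c w)"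
    using boundary_map_alt[OF V(1,2) assms(2)] sum.remove[OF _ V(4)] V(1) by simp
  moreover have "boundary_map (deletion \<Delta> v) (avoiding_part v c) \<tau> =
      ?f (avoiding_part v c) v + (\<Sum>w\<in>V - \<tau> - {v}. ?f (avoiding_part v c) w)"
    using boundary_map_alt[OF V(1,3) sup] sum.remove[OF _ V(4)] V(1) by simp
  moreover have "(\<Sum>w\<in>V - \<tau> - {v}. ?f (avoiding_part v c) w) = (\<Sum>w\<in>V - \<tau> - {v}. ?f c w)"
    using False by (intro sum.cong) (auto simp: avoiding_part_def)
  ultimately show ?thesis
    using False by (simp add: avoiding_part_def slice_def)
qed

text \<open>Second component of the mapping cone boundary.\<close>

lemma slice_boundary:
  assumes "simplicial_complex \<Delta>" "c \<in> chain_space \<Delta> k"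
  shows "slice v (boundary_map \<Delta> c) \<tau> = - boundary_map (link \<Delta> v) (slice v c) \<tau>"
proof (cases "v \<in> \<tau>")
  case True
  then have "{w. w \<notin> \<tau> \<and> \<tau> \<union> {w} \<in> link \<Delta> v} = {}"
    by (auto simp: link_def deletion_def)
  then show ?thesis
    using True unfolding boundary_map_def by (simp add: slice_def)
next
  case False
  define V where "V = insert v (\<Union>\<Delta>)"
  have V: "finite V" "\<Union>\<Delta> \<subseteq> V" "\<Union>(link \<Delta> v) \<subseteq> V" "v \<in> V - \<tau>"
    using simplicial_finite_Union[OF assms(1)] False by (auto simp: V_def link_def deletion_def)
  have sup: "supported_on \<Delta> c" "supported_on (link \<Delta> v) (slice v c)"
    using chain_space_supported[OF assms(2)] chain_space_supported[OF chain_space_slice[OF assms]]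
    by auto
  have swap: "(-1) ^ vertex_pos v \<tau> * ((-1) ^ vertex_pos w (insert v \<tau>) * c (insert w (insert v \<tau>))) =
      - ((-1) ^ vertex_pos w \<tau> * slice v c (insert w \<tau>))" if w: "w \<in> V - \<tau> - {v}" for w
  proof (cases "finite \<tau>")
    case True
    have "v \<noteq> w"
      using w by blast
    with True show ?thesis
      using w False vertex_sign_swap[of \<tau> v w, where ?'k = 'b]
      by (simp add: slice_def insert_commute[of v w] flip: mult.assoc)
  next
    case infinite: False
    \<comment> \<open>Positions are meaningless in an infinite set, but it is not a face.\<close>
    then have "insert w (insert v \<tau>) \<notin> \<Delta>"
      using assms(1) unfolding simplicial_complex_def by auto
    then have "c (insert w (insert v \<tau>)) = 0"
      using sup(1) by (auto simp: supported_on_def)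
    then show ?thesis
      by (simp add: slice_def insert_commute)
  qed
  have "slice v (boundary_map \<Delta> c) \<tau> = (\<Sum>w\<in>V - \<tau> - {v}.
      (-1) ^ vertex_pos v \<tau> * ((-1) ^ vertex_pos w (insert v \<tau>) * c (insert w (insert v \<tau>))))"
    using False boundary_map_alt[OF V(1,2) sup(1), of "insert v \<tau>"]
    by (simp add: slice_def sum_distrib_left Diff_insert[of V v \<tau>])
  also have "\<dots> = - (\<Sum>w\<in>V - \<tau> - {v}. (-1) ^ vertex_pos w \<tau> * slice v c (insert w \<tau>))"
    using swap by (simp add: sum_negf)
  also have "(\<Sum>w\<in>V - \<tau> - {v}. (-1) ^ vertex_pos w \<tau> * slice v c (insert w \<tau>)) =
      boundary_map (link \<Delta> v) (slice v c) \<tau>"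
    using boundary_map_alt[OF V(1,3) sup(2), of \<tau>] V(1)
      sum.remove[OF _ V(4), of "\<lambda>w. (-1) ^ vertex_pos w \<tau> * slice v c (insert w \<tau>)"]
    by (simp add: slice_def[of v c "insert v \<tau>"])
  finally show ?thesis .
qed

lemma boundary_cone:
  assumes "simplicial_complex \<Delta>" "l \<in> chain_space (link \<Delta> v) k"
  shows "avoiding_part v (boundary_map \<Delta> (cone v l)) = l"
    and "slice v (boundary_map \<Delta> (cone v l)) = (\<lambda>\<tau>. - boundary_map (link \<Delta> v) l \<tau>)"
proof -
  note cone = chain_space_cone[OF assms]
  have sc: "slice v (cone v l) = l"
    by (rule slice_cone[OF chain_space_supported[OF assms(2)]])
  show "avoiding_part v (boundary_map \<Delta> (cone v l)) = l"
    using avoiding_part_boundary[OF assms(1) chain_space_supported[OF cone], of v] sc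
    by (simp add: avoiding_part_cone boundary_map_zero fun_eq_iff)
  show "slice v (boundary_map \<Delta> (cone v l)) = (\<lambda>\<tau>. - boundary_map (link \<Delta> v) l \<tau>)"
    using slice_boundary[OF assms(1) cone, of v] sc by (simp add: fun_eq_iff)
qed

context
  fixes \<Delta> :: "'a set set" and v :: 'a
  assumes simplicial: "simplicial_complex \<Delta>"
begin

lemma boundary_link_in_deletion:
  "l \<in> chain_space (link \<Delta> v) k \<Longrightarrow> boundary_map (link \<Delta> v) l = boundary_map (deletion \<Delta> v) l"
  by (intro boundary_map_subcomplex[OF simplicial_deletion[OF simplicial] link_subset_deletion]
      chain_space_supported)

lemma chain_space_link_in_deletion:
  "l \<in> chain_space (link \<Delta> v) k \<Longrightarrow> l \<in> chain_space (deletion \<Delta> v) k"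
  using link_subset_deletion[of \<Delta> v] by (auto simp: chain_space_def)

text \<open>The following lemmas state, in terms of cycles, that the long exact sequence is exact at its
  three terms. Its maps are induced by the two inclusions and by \<open>slice v\<close>, which is the connecting
  map of degree \<open>-1\<close>. At the deletion: if $z = \partial(d, l)$ then $z = \partial d + l$.\<close>

lemma exact_at_deletion:
  assumes "z \<in> cycles (deletion \<Delta> v) k" "z \<in> boundaries \<Delta> k"
  obtains l where "l \<in> cycles (link \<Delta> v) k" "(\<lambda>\<sigma>. z \<sigma> - l \<sigma>) \<in> boundaries (deletion \<Delta> v) k"
proof -
  obtain c where c: "c \<in> chain_space \<Delta> (k + 1)" "z = boundary_map \<Delta> c"
    using assms(2) by (auto simp: boundaries_def)
  have z: "supported_on (deletion \<Delta> v) z"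
    using assms(1) by (auto simp: cycles_def intro: chain_space_supported)
  have "boundary_map (link \<Delta> v) (slice v c) = (\<lambda>_. 0)"
    using slice_boundary[OF simplicial c(1), of v] slice_deletion[OF z] c(2)
    by (simp add: fun_eq_iff)
  then have l: "slice v c \<in> cycles (link \<Delta> v) k"
    using chain_space_slice[OF simplicial c(1), of v] by (simp add: cycles_def)
  have "(\<lambda>\<sigma>. z \<sigma> - slice v c \<sigma>) = boundary_map (deletion \<Delta> v) (avoiding_part v c)"
    using avoiding_part_boundary[OF simplicial chain_space_supported[OF c(1)], of v]
      avoiding_part_deletion[OF z] c(2) by (simp add: fun_eq_iff algebra_simps)
  then have "(\<lambda>\<sigma>. z \<sigma> - slice v c \<sigma>) \<in> boundaries (deletion \<Delta> v) k"
    using chain_space_avoiding_part[OF c(1)] by (simp add: boundaries_def)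
  with l show thesis
    by (rule that)
qed

text \<open>A cycle of the link is the boundary of the cone over it with apex \<open>v\<close>.\<close>

lemma link_cycle_bounds:
  assumes "l \<in> cycles (link \<Delta> v) k"
  shows "l \<in> boundaries \<Delta> k"
proof -
  have l: "l \<in> chain_space (link \<Delta> v) k" "boundary_map (link \<Delta> v) l = (\<lambda>_. 0)"
    using assms by (auto simp: cycles_def)
  have sup: "supported_on (deletion \<Delta> v) l"
    by (rule chain_space_supported[OF chain_space_link_in_deletion[OF l(1)]])
  have "boundary_map \<Delta> (cone v l) = l"
    using boundary_cone[OF simplicial l(1)] l(2)
    by - (rule chain_ext[of v], simp_all add: avoiding_part_deletion[OF sup] slice_deletion[OF sup])
  then show ?thesis
    unfolding boundaries_def using chain_space_cone[OF simplicial l(1)]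
    by (intro image_eqI[of _ _ "cone v l"]) simp_all
qed

text \<open>If the link component of $c = (d, l)$ is $l = \partial b$, subtracting the boundary of
  $(0, -b)$ removes it and leaves the chain $d + b$ on the deletion.\<close>

lemma exact_at_complex:
  assumes "c \<in> cycles \<Delta> k" "slice v c \<in> boundaries (link \<Delta> v) (k - 1)"
  obtains d where "d \<in> cycles (deletion \<Delta> v) k" "(\<lambda>\<sigma>. c \<sigma> - d \<sigma>) \<in> boundaries \<Delta> k"
proof -
  obtain b where b: "b \<in> chain_space (link \<Delta> v) k" "slice v c = boundary_map (link \<Delta> v) b"
    using assms(2) by (auto simp: boundaries_def)
  let ?d = "\<lambda>\<sigma>. 1 * avoiding_part v c \<sigma> + 1 * b \<sigma>"
  have c: "c \<in> chain_space \<Delta> k" "boundary_map \<Delta> c = (\<lambda>_. 0)"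
    using assms(1) by (auto simp: cycles_def)
  note b' = chain_space_link_in_deletion[OF b(1)]
  have d: "?d \<in> chain_space (deletion \<Delta> v) k"
    by (intro chain_space_combination chain_space_avoiding_part c b')
  have "slice v c \<tau> + boundary_map (deletion \<Delta> v) (avoiding_part v c) \<tau> = 0" for \<tau>
    using avoiding_part_boundary[OF simplicial chain_space_supported[OF c(1)], of v \<tau>] c(2)
    by (simp add: avoiding_part_def)
  then have "boundary_map (deletion \<Delta> v) ?d = (\<lambda>_. 0)"
    unfolding boundary_map_combination fun_eq_iff
    using b(2) boundary_link_in_deletion[OF b(1)] by (simp add: add.commute)
  then have d': "?d \<in> cycles (deletion \<Delta> v) k"
    using d by (simp add: cycles_def)
  have slb: "slice v b = (\<lambda>_. 0)" "avoiding_part v b = b"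
    using chain_space_supported[OF b'] by (simp_all add: slice_deletion avoiding_part_deletion)
  have sla: "slice v (avoiding_part v c) = (\<lambda>_. 0)"
    "avoiding_part v (avoiding_part v c) = avoiding_part v c"
    by (auto simp: slice_def avoiding_part_def fun_eq_iff)
  let ?x = "boundary_map \<Delta> (cone v b)"
  have eq: "(\<lambda>\<sigma>. 1 * c \<sigma> + (-1) * ?d \<sigma>) = (\<lambda>\<sigma>. (-1) * ?x \<sigma> + 0 * ?x \<sigma>)"
    by (rule chain_ext[of v], unfold slice_combination avoiding_part_combination)
      (simp_all add: slb sla boundary_cone[OF simplicial b(1)] b(2))
  have x: "?x \<in> boundaries \<Delta> k"
    using chain_space_cone[OF simplicial b(1)] by (simp add: boundaries_def)
  have "(\<lambda>\<sigma>. c \<sigma> - ?d \<sigma>) \<in> boundaries \<Delta> k"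
    by (rule boundaries_scale[OF x, where a = "-1"])
      (use fun_cong[OF eq] in \<open>simp add: algebra_simps\<close>)
  with d' show thesis
    by (rule that)
qed

lemma slice_of_boundary:
  assumes "c \<in> boundaries \<Delta> k"
  shows "slice v c \<in> boundaries (link \<Delta> v) (k - 1)"
proof -
  obtain b where b: "b \<in> chain_space \<Delta> (k + 1)" "c = boundary_map \<Delta> b"
    using assms by (auto simp: boundaries_def)
  have "boundary_map (link \<Delta> v) (slice v b) \<in> boundaries (link \<Delta> v) (k - 1)"
    using chain_space_slice[OF simplicial b(1), of v] by (simp add: boundaries_def)
  then show ?thesis
    by (rule boundaries_scale[where a = "-1"]) (simp add: b slice_boundary[OF simplicial b(1)])
qed

text \<open>If $l = \partial y$ in the deletion, then $(-y, l)$ is a cycle.\<close>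

lemma exact_at_link:
  assumes "l \<in> cycles (link \<Delta> v) (k - 1)" "l \<in> boundaries (deletion \<Delta> v) (k - 1)"
  obtains c where "c \<in> cycles \<Delta> k" "slice v c = l"
proof -
  obtain y where y: "y \<in> chain_space (deletion \<Delta> v) k" "l = boundary_map (deletion \<Delta> v) y"
    using assms(2) by (auto simp: boundaries_def)
  have l: "l \<in> chain_space (link \<Delta> v) (k - 1)" "boundary_map (link \<Delta> v) l = (\<lambda>_. 0)"
    using assms(1) by (auto simp: cycles_def)
  let ?c = "\<lambda>\<sigma>. 1 * cone v l \<sigma> + (-1) * y \<sigma>"
  have y': "y \<in> chain_space \<Delta> k"
    using y(1) by (auto simp: chain_space_def deletion_def)
  have c: "?c \<in> chain_space \<Delta> k"
    using chain_space_cone[OF simplicial l(1)] y' by (intro chain_space_combination) simp_all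
  note sup = chain_space_supported[OF y(1)]
  have sl: "slice v ?c = l"
    unfolding slice_combination using slice_cone[OF chain_space_supported[OF l(1)]]
    by (simp add: slice_deletion[OF sup])
  have av: "avoiding_part v ?c = (\<lambda>\<sigma>. 0 * y \<sigma> + (-1) * y \<sigma>)"
    unfolding avoiding_part_combination
    by (simp add: avoiding_part_cone avoiding_part_deletion[OF sup])
  have "boundary_map \<Delta> ?c = (\<lambda>_. 0)"
  proof (rule chain_ext[of v])
    show "slice v (boundary_map \<Delta> ?c) = slice v (\<lambda>_. 0)"
      unfolding fun_eq_iff slice_boundary[OF simplicial c] sl l(2) by (simp add: slice_def)
    have "boundary_map (deletion \<Delta> v) (avoiding_part v ?c) \<tau> = - l \<tau>" for \<tau>
      unfolding av by (simp only: boundary_map_combination) (simp add: y(2))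
    then show "avoiding_part v (boundary_map \<Delta> ?c) = avoiding_part v (\<lambda>_. 0)"
      unfolding fun_eq_iff avoiding_part_boundary[OF simplicial chain_space_supported[OF c]] sl
      by (simp add: avoiding_part_def)
  qed
  then have "?c \<in> cycles \<Delta> k"
    using c by (simp add: cycles_def)
  from this sl show thesis
    by (rule that)
qed

lemma slice_of_cycle:
  assumes "c \<in> cycles \<Delta> k"
  shows "slice v c \<in> cycles (link \<Delta> v) (k - 1)" "slice v c \<in> boundaries (deletion \<Delta> v) (k - 1)"
proof -
  have c: "c \<in> chain_space \<Delta> k" "boundary_map \<Delta> c = (\<lambda>_. 0)"
    using assms by (auto simp: cycles_def)
  have "boundary_map (link \<Delta> v) (slice v c) \<tau> = 0" for \<tau>
    using slice_boundary[OF simplicial c(1), of v \<tau>] c(2) by (simp add: slice_def split: if_splits)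
  then show "slice v c \<in> cycles (link \<Delta> v) (k - 1)"
    using chain_space_slice[OF simplicial c(1)] by (auto simp: cycles_def)
  have "slice v c \<tau> = - 1 * boundary_map (deletion \<Delta> v) (avoiding_part v c) \<tau>" for \<tau>
    using avoiding_part_boundary[OF simplicial chain_space_supported[OF c(1)], of v \<tau>] c(2)
    by (simp add: avoiding_part_def add_eq_0_iff2)
  moreover have "boundary_map (deletion \<Delta> v) (avoiding_part v c) \<in> boundaries (deletion \<Delta> v) (k - 1)"
    using chain_space_avoiding_part[OF c(1)] by (simp add: boundaries_def)
  ultimately show "slice v c \<in> boundaries (deletion \<Delta> v) (k - 1)"
    by (rule boundaries_scale[rotated])
qed

end

section \<open>Parity of the number of non-acyclic minors\<close>

lemma spherical_simplicial: "spherical K \<Delta> \<Longrightarrow> simplicial_complex \<Delta>"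
  by (erule spherical.cases) simp

lemma spherical_zero_or_line: "spherical K \<Delta> \<Longrightarrow> homology_zero K \<Delta> k \<or> homology_line K \<Delta> k"
  by (erule spherical.cases) simp

lemma spherical_line_unique:
  "spherical K \<Delta> \<Longrightarrow> homology_line K \<Delta> i \<Longrightarrow> homology_line K \<Delta> j \<Longrightarrow> i = j"
  by (erule spherical.cases) simp

lemma spherical_void: "spherical K ({} :: 'a set set)"
proof -
  have "homology_zero K ({} :: 'a set set) k" for k
    by (auto simp: homology_zero_iff cycles_def chain_space_def boundaries_zero simp flip: fun_eq_iff)
  then show ?thesis
    by (intro spherical.intros)
      (auto simp: simplicial_complex_def vertices_def dest: homology_line_not_zero)
qed

lemma spherical_link_deletion:
  assumes "spherical K \<Delta>"
  shows "spherical K (link \<Delta> v)" "spherical K (deletion \<Delta> v)"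
proof -
  have "spherical K (link \<Delta> v) \<and> spherical K (deletion \<Delta> v)"
  proof (cases "v \<in> vertices \<Delta>")
    case True
    then show ?thesis
      using assms by (auto elim: spherical.cases)
  next
    case False
    then show ?thesis
      using assms spherical_void by (simp add: non_vertex[OF spherical_simplicial[OF assms]])
  qed
  then show "spherical K (link \<Delta> v)" "spherical K (deletion \<Delta> v)"
    by auto
qed

definition non_acyclic :: "'k::field itself \<Rightarrow> 'a set set \<Rightarrow> bool" where
  "non_acyclic K \<Delta> \<longleftrightarrow> (\<exists>k. homology_line K \<Delta> k)"

lemma acyclic_complex_iff:
  "spherical K \<Delta> \<Longrightarrow> acyclic_complex K \<Delta> \<longleftrightarrow> \<not> non_acyclic K \<Delta>"
  unfolding acyclic_complex_def non_acyclic_def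
  using spherical_zero_or_line homology_line_not_zero by blast

lemma spherical_sphere_homology:
  assumes "spherical K \<Delta>" "homology_line K \<Delta> k"
  shows "sphere_homology K k \<Delta>"
proof -
  have "k \<ge> -1"
    using homology_line_face[OF assms(2)] by fastforce
  then show ?thesis
    unfolding sphere_homology_def
    using assms spherical_zero_or_line spherical_line_unique by blast
qed

text \<open>In degrees other than \<open>i\<close> every cycle bounds, so the scalar may be taken to be zero there.
  This treats all degrees of the homology with one generator, as if it were ungraded.\<close>

lemma spherical_generator:
  fixes K :: "'k::field itself" and \<Delta> :: "'a set set"
  assumes "spherical K \<Delta>" "homology_line K \<Delta> i"
  obtains g :: "'a set \<Rightarrow> 'k" where "g \<in> cycles \<Delta> i" "g \<notin> boundaries \<Delta> i"
    "\<forall>j. \<forall>z\<in>cycles \<Delta> j. \<exists>a. (a = 0 \<or> j = i) \<and> (\<lambda>\<sigma>. z \<sigma> - a * g \<sigma>) \<in> boundaries \<Delta> j"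
proof -
  obtain g :: "'a set \<Rightarrow> 'k" where g: "g \<in> cycles \<Delta> i" "g \<notin> boundaries \<Delta> i"
    "\<forall>z\<in>cycles \<Delta> i. \<exists>a. (\<lambda>\<sigma>. z \<sigma> - a * g \<sigma>) \<in> boundaries \<Delta> i"
    by (rule homology_line_generator[OF assms(2)])
  have "\<exists>a. (a = 0 \<or> j = i) \<and> (\<lambda>\<sigma>. z \<sigma> - a * g \<sigma>) \<in> boundaries \<Delta> j"
    if z: "z \<in> cycles \<Delta> j" for j z
  proof (cases "j = i")
    case True
    then show ?thesis
      using g(3) z by auto
  next
    case False
    then have "homology_zero K \<Delta> j"
      using spherical_zero_or_line[OF assms(1)] spherical_line_unique[OF assms(1) assms(2)] by blast
    then have "z \<in> boundaries \<Delta> j"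
      using z by (auto simp: homology_zero_iff)
    then show ?thesis
      by (intro exI[of _ 0]) simp
  qed
  then have "\<forall>j. \<forall>z\<in>cycles \<Delta> j. \<exists>a. (a = 0 \<or> j = i) \<and> (\<lambda>\<sigma>. z \<sigma> - a * g \<sigma>) \<in> boundaries \<Delta> j"
    by auto
  with g(1,2) show thesis
    by (rule that)
qed

lemma not_non_acyclic_bounds:
  fixes K :: "'k::field itself" and z :: "'a set \<Rightarrow> 'k"
  assumes "spherical K \<Delta>" "\<not> non_acyclic K \<Delta>" "z \<in> cycles \<Delta> k"
  shows "z \<in> boundaries \<Delta> k"
proof -
  have "homology_zero K \<Delta> k"
    using assms(1,2) spherical_zero_or_line by (auto simp: non_acyclic_def)
  then show ?thesis
    using assms(3) by (auto simp: homology_zero_iff)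
qed

lemma homology_lineI:
  fixes K :: "'k::field itself" and z :: "'a set \<Rightarrow> 'k"
  assumes "spherical K \<Delta>" "z \<in> cycles \<Delta> k" "z \<notin> boundaries \<Delta> k"
  shows "homology_line K \<Delta> k"
  using assms(2,3) spherical_zero_or_line[OF assms(1), of k] by (auto simp: homology_zero_iff)

context
  fixes K :: "'k::field itself" and \<Delta> :: "'a set set" and v :: 'a
  assumes spherical: "spherical K \<Delta>"
begin

lemmas simplicial = spherical_simplicial[OF spherical]
lemmas spherical_minors = spherical_link_deletion[OF spherical, of v]

lemma deletion_in_complex:
  "z \<in> cycles (deletion \<Delta> v) k \<Longrightarrow> z \<in> cycles \<Delta> k"
  "z \<in> boundaries (deletion \<Delta> v) k \<Longrightarrow> z \<in> boundaries \<Delta> k"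
  using cycles_subcomplex[OF simplicial deletion_subset] boundaries_subcomplex[OF simplicial deletion_subset]
  by blast+

lemma link_in_deletion:
  "z \<in> boundaries (link \<Delta> v) k \<Longrightarrow> z \<in> boundaries (deletion \<Delta> v) k"
  "z \<in> cycles (link \<Delta> v) k \<Longrightarrow> z \<in> cycles (deletion \<Delta> v) k"
  using cycles_subcomplex[OF simplicial_deletion[OF simplicial] link_subset_deletion]
    boundaries_subcomplex[OF simplicial_deletion[OF simplicial] link_subset_deletion]
  by blast+

text \<open>With an acyclic link the map from the homology of the deletion is injective.\<close>

lemma homology_line_from_deletion:
  assumes "\<not> non_acyclic K (link \<Delta> v)" "homology_line K (deletion \<Delta> v) k"
  shows "homology_line K \<Delta> k"
proof -
  obtain y :: "'a set \<Rightarrow> 'k" where y: "y \<in> cycles (deletion \<Delta> v) k" "y \<notin> boundaries (deletion \<Delta> v) k"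
    by (rule homology_line_generator[OF assms(2)])
  have "y \<notin> boundaries \<Delta> k"
  proof
    assume "y \<in> boundaries \<Delta> k"
    then obtain l where l: "l \<in> cycles (link \<Delta> v) k"
      and yl: "(\<lambda>\<sigma>. y \<sigma> - l \<sigma>) \<in> boundaries (deletion \<Delta> v) k"
      by (rule exact_at_deletion[OF simplicial y(1)])
    have "l \<in> boundaries (deletion \<Delta> v) k"
      by (intro link_in_deletion not_non_acyclic_bounds[OF spherical_minors(1) assms(1)] l)
    then have "y \<in> boundaries (deletion \<Delta> v) k"
      by (rule boundaries_combination[OF yl, where a = 1 and b = 1]) simp
    with y(2) show False ..
  qed
  then show ?thesis
    by (rule homology_lineI[OF spherical deletion_in_complex(1)[OF y(1)]])
qed

text \<open>With an acyclic deletion the connecting map to the homology of the link is surjective.\<close>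

lemma homology_line_from_link:
  assumes "\<not> non_acyclic K (deletion \<Delta> v)" "homology_line K (link \<Delta> v) (k - 1)"
  shows "homology_line K \<Delta> k"
proof -
  obtain z :: "'a set \<Rightarrow> 'k" where z: "z \<in> cycles (link \<Delta> v) (k - 1)" "z \<notin> boundaries (link \<Delta> v) (k - 1)"
    by (rule homology_line_generator[OF assms(2)])
  have "z \<in> boundaries (deletion \<Delta> v) (k - 1)"
    by (intro not_non_acyclic_bounds[OF spherical_minors(2) assms(1)] link_in_deletion z)
  then obtain c where c: "c \<in> cycles \<Delta> k" "slice v c = z"
    by (rule exact_at_link[OF simplicial z(1)])
  have "c \<notin> boundaries \<Delta> k"
    using slice_of_boundary[OF simplicial, of c k v] c(2) z(2) by auto
  then show ?thesis
    by (rule homology_lineI[OF spherical c(1)])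
qed

lemma acyclic_from_minors:
  assumes "\<not> non_acyclic K (deletion \<Delta> v)" "\<not> non_acyclic K (link \<Delta> v)"
  shows "\<not> non_acyclic K \<Delta>"
proof
  assume "non_acyclic K \<Delta>"
  then obtain k where "homology_line K \<Delta> k"
    by (auto simp: non_acyclic_def)
  then obtain c :: "'a set \<Rightarrow> 'k" where c: "c \<in> cycles \<Delta> k" "c \<notin> boundaries \<Delta> k"
    by (rule homology_line_generator)
  have "slice v c \<in> boundaries (link \<Delta> v) (k - 1)"
    by (intro not_non_acyclic_bounds[OF spherical_minors(1) assms(2)] slice_of_cycle[OF simplicial] c)
  then obtain d where d: "d \<in> cycles (deletion \<Delta> v) k" "(\<lambda>\<sigma>. c \<sigma> - d \<sigma>) \<in> boundaries \<Delta> k"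
    by (rule exact_at_complex[OF simplicial c(1)])
  have "d \<in> boundaries \<Delta> k"
    by (intro deletion_in_complex not_non_acyclic_bounds[OF spherical_minors(2) assms(1)] d)
  then have "c \<in> boundaries \<Delta> k"
    by (rule boundaries_combination[OF d(2), where a = 1 and b = 1]) simp
  with c(2) show False ..
qed

text \<open>An exact triangle cannot consist of three lines: a map between lines is zero or bijective,
  and by exactness zero and bijective maps would have to alternate around the triangle, which has an
  odd number of maps. In the proof \<open>z\<close>, \<open>y\<close>, \<open>c\<close> generate the homology of link, deletion and
  complex, and the case distinction is whether the map from deletion to complex is zero.\<close>

lemma acyclic_from_non_acyclic_minors:
  assumes "non_acyclic K (deletion \<Delta> v)" "non_acyclic K (link \<Delta> v)"
  shows "\<not> non_acyclic K \<Delta>"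
proof
  assume "non_acyclic K \<Delta>"
  then obtain k where k: "homology_line K \<Delta> k"
    by (auto simp: non_acyclic_def)
  obtain i j where i: "homology_line K (link \<Delta> v) i" and j: "homology_line K (deletion \<Delta> v) j"
    using assms by (auto simp: non_acyclic_def)
  obtain z :: "'a set \<Rightarrow> 'k" where z: "z \<in> cycles (link \<Delta> v) i" "z \<notin> boundaries (link \<Delta> v) i"
    and gen_z: "\<forall>m. \<forall>x\<in>cycles (link \<Delta> v) m.
      \<exists>a. (a = 0 \<or> m = i) \<and> (\<lambda>\<sigma>. x \<sigma> - a * z \<sigma>) \<in> boundaries (link \<Delta> v) m"
    by (rule spherical_generator[OF spherical_minors(1) i])
  obtain y :: "'a set \<Rightarrow> 'k" where y: "y \<in> cycles (deletion \<Delta> v) j" "y \<notin> boundaries (deletion \<Delta> v) j"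
    and gen_y: "\<forall>m. \<forall>x\<in>cycles (deletion \<Delta> v) m.
      \<exists>a. (a = 0 \<or> m = j) \<and> (\<lambda>\<sigma>. x \<sigma> - a * y \<sigma>) \<in> boundaries (deletion \<Delta> v) m"
    by (rule spherical_generator[OF spherical_minors(2) j])
  obtain c :: "'a set \<Rightarrow> 'k" where c: "c \<in> cycles \<Delta> k" "c \<notin> boundaries \<Delta> k"
    and gen_c: "\<forall>m. \<forall>x\<in>cycles \<Delta> m.
      \<exists>a. (a = 0 \<or> m = k) \<and> (\<lambda>\<sigma>. x \<sigma> - a * c \<sigma>) \<in> boundaries \<Delta> m"
    by (rule spherical_generator[OF spherical k])
  show False
  proof (cases "y \<in> boundaries \<Delta> j")
    case True
    \<comment> \<open>Then the map from link to deletion is bijective, so the connecting map is zero and \<open>c\<close>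
      comes from the deletion, where it is a multiple of \<open>y\<close>.\<close>
    obtain l where l: "l \<in> cycles (link \<Delta> v) j"
      and yl: "(\<lambda>\<sigma>. y \<sigma> - l \<sigma>) \<in> boundaries (deletion \<Delta> v) j"
      by (rule exact_at_deletion[OF simplicial y(1) True])
    obtain a where a: "a = 0 \<or> j = i" and lz: "(\<lambda>\<sigma>. l \<sigma> - a * z \<sigma>) \<in> boundaries (link \<Delta> v) j"
      using gen_z l by blast
    have yz: "(\<lambda>\<sigma>. y \<sigma> - a * z \<sigma>) \<in> boundaries (deletion \<Delta> v) j"
      by (rule boundaries_combination[OF yl link_in_deletion(1)[OF lz], where a = 1 and b = 1]) simp
    have z_not: "z \<notin> boundaries (deletion \<Delta> v) i" and ij: "j = i"
    proof -
      have "a \<noteq> 0"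
        using yz y(2) by auto
      then show "j = i"
        using a by simp
      show "z \<notin> boundaries (deletion \<Delta> v) i"
      proof
        assume "z \<in> boundaries (deletion \<Delta> v) i"
        then have "z \<in> boundaries (deletion \<Delta> v) j"
          using \<open>j = i\<close> by simp
        then have "y \<in> boundaries (deletion \<Delta> v) j"
          by (rule boundaries_combination[OF yz, where a = 1 and b = a]) simp
        with y(2) show False ..
      qed
    qed
    obtain b where b: "b = 0 \<or> k - 1 = i"
      and cz: "(\<lambda>\<sigma>. slice v c \<sigma> - b * z \<sigma>) \<in> boundaries (link \<Delta> v) (k - 1)"
      using gen_z slice_of_cycle(1)[OF simplicial c(1)] by blast
    have "b = 0"
    proof (rule ccontr)
      assume "b \<noteq> 0"
      have "z \<in> boundaries (deletion \<Delta> v) (k - 1)"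
        by (rule boundaries_combination[OF slice_of_cycle(2)[OF simplicial c(1)]
              link_in_deletion(1)[OF cz], where a = "1 / b" and b = "- 1 / b"])
          (use \<open>b \<noteq> 0\<close> in \<open>simp add: field_simps\<close>)
      with b \<open>b \<noteq> 0\<close> z_not show False
        by simp
    qed
    then have "slice v c \<in> boundaries (link \<Delta> v) (k - 1)"
      using cz by simp
    then obtain d where d: "d \<in> cycles (deletion \<Delta> v) k" "(\<lambda>\<sigma>. c \<sigma> - d \<sigma>) \<in> boundaries \<Delta> k"
      by (rule exact_at_complex[OF simplicial c(1)])
    obtain e where e: "e = 0 \<or> k = j" and dy: "(\<lambda>\<sigma>. d \<sigma> - e * y \<sigma>) \<in> boundaries (deletion \<Delta> v) k"
      using gen_y d(1) by blast
    have cy: "(\<lambda>\<sigma>. c \<sigma> - e * y \<sigma>) \<in> boundaries \<Delta> k"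
      by (rule boundaries_combination[OF d(2) deletion_in_complex(2)[OF dy], where a = 1 and b = 1]) simp
    have "(\<lambda>\<sigma>. e * y \<sigma>) \<in> boundaries \<Delta> k"
      using e boundaries_scale[OF True, of "\<lambda>\<sigma>. e * y \<sigma>" e] by (auto simp: boundaries_zero)
    then have "c \<in> boundaries \<Delta> k"
      by (rule boundaries_combination[OF cy, where a = 1 and b = 1]) simp
    with c(2) show False ..
  next
    case False
    \<comment> \<open>Then \<open>y\<close> generates the homology of the complex, so the connecting map is zero and the map
      from link to deletion is injective. So \<open>y\<close> comes from the link, whose cycles bound in
      the complex.\<close>
    obtain a where a: "a = 0 \<or> j = k" and yc: "(\<lambda>\<sigma>. y \<sigma> - a * c \<sigma>) \<in> boundaries \<Delta> j"
      using gen_c deletion_in_complex(1)[OF y(1)] by blast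
    have "a \<noteq> 0"
      using yc False by auto
    then have "j = k"
      using a by simp
    have y0: "slice v y = (\<lambda>_. 0)"
      using y(1) by (intro slice_deletion chain_space_supported) (auto simp: cycles_def)
    have slice_c: "slice v c \<in> boundaries (link \<Delta> v) (k - 1)"
    proof -
      have "slice v (\<lambda>\<sigma>. 1 * y \<sigma> + (- a) * c \<sigma>) \<in> boundaries (link \<Delta> v) (k - 1)"
        using slice_of_boundary[OF simplicial yc, of v] \<open>j = k\<close> by simp
      then show ?thesis
        unfolding slice_combination y0
        by (rule boundaries_scale[where a = "- 1 / a"]) (use \<open>a \<noteq> 0\<close> in simp)
    qed
    have slice_bounds: "slice v x \<in> boundaries (link \<Delta> v) (m - 1)" if x: "x \<in> cycles \<Delta> m"
      for x :: "'a set \<Rightarrow> 'k" and m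
    proof -
      obtain b where b: "b = 0 \<or> m = k" and xc: "(\<lambda>\<sigma>. x \<sigma> - b * c \<sigma>) \<in> boundaries \<Delta> m"
        using gen_c x by blast
      have "slice v (\<lambda>\<sigma>. 1 * x \<sigma> + (- b) * c \<sigma>) \<in> boundaries (link \<Delta> v) (m - 1)"
        using slice_of_boundary[OF simplicial xc, of v] by simp
      then have 1: "(\<lambda>\<sigma>. 1 * slice v x \<sigma> + (- b) * slice v c \<sigma>) \<in> boundaries (link \<Delta> v) (m - 1)"
        by (simp only: slice_combination)
      have "(\<lambda>\<sigma>. b * slice v c \<sigma>) \<in> boundaries (link \<Delta> v) (m - 1)"
        using b boundaries_scale[OF slice_c, of "\<lambda>\<sigma>. b * slice v c \<sigma>" b]
        by (auto simp: boundaries_zero)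
      then show ?thesis
        by (rule boundaries_combination[OF 1, where a = 1 and b = 1]) simp
    qed
    have z_not: "z \<notin> boundaries (deletion \<Delta> v) i"
    proof
      assume "z \<in> boundaries (deletion \<Delta> v) i"
      then obtain x where x: "x \<in> cycles \<Delta> (i + 1)" "slice v x = z"
        using exact_at_link[OF simplicial, of z v "i + 1"] z(1) by auto
      with slice_bounds[OF x(1)] z(2) show False
        by simp
    qed
    obtain b where b: "b = 0 \<or> i = j" and zy: "(\<lambda>\<sigma>. z \<sigma> - b * y \<sigma>) \<in> boundaries (deletion \<Delta> v) i"
      using gen_y link_in_deletion(2)[OF z(1)] by blast
    have "b \<noteq> 0"
      using zy z_not by auto
    have "y \<in> boundaries \<Delta> i"
      by (rule boundaries_combination[OF link_cycle_bounds[OF simplicial z(1)]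
            deletion_in_complex(2)[OF zy], where a = "1 / b" and b = "- 1 / b"])
        (use \<open>b \<noteq> 0\<close> in \<open>simp add: field_simps\<close>)
    with b \<open>b \<noteq> 0\<close> False show False
      by simp
  qed
qed

lemma non_acyclic_parity:
  "non_acyclic K \<Delta> \<longleftrightarrow> (non_acyclic K (deletion \<Delta> v) \<longleftrightarrow> \<not> non_acyclic K (link \<Delta> v))"
proof -
  have "non_acyclic K \<Delta>" if "non_acyclic K (deletion \<Delta> v)" "\<not> non_acyclic K (link \<Delta> v)"
    using homology_line_from_deletion[OF that(2)] that(1) by (auto simp: non_acyclic_def)
  moreover have "non_acyclic K \<Delta>" if na: "\<not> non_acyclic K (deletion \<Delta> v)" "non_acyclic K (link \<Delta> v)"
  proof -
    obtain k where "homology_line K (link \<Delta> v) (k + 1 - 1)"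
      using na(2) by (auto simp: non_acyclic_def)
    from homology_line_from_link[OF na(1) this] show ?thesis
      by (auto simp: non_acyclic_def)
  qed
  ultimately show ?thesis
    using acyclic_from_minors acyclic_from_non_acyclic_minors by blast
qed

end

section \<open>The sign\<close>

definition acyclicity_sign :: "'k::field itself \<Rightarrow> 'a set set \<Rightarrow> int" where
  "acyclicity_sign K \<Delta> = (if non_acyclic K \<Delta> then -1 else 1)"

lemma acyclicity_sign_mult:
  "spherical K \<Delta> \<Longrightarrow>
     acyclicity_sign K (deletion \<Delta> v) * acyclicity_sign K (link \<Delta> v) = acyclicity_sign K \<Delta>"
  using non_acyclic_parity[of K \<Delta> v] by (simp add: acyclicity_sign_def)

lemma minor_empty: "minor \<Delta> {} {} = \<Delta>"
  by (simp add: minor_def)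

lemma minor_insert_deletion:
  "finite Y \<Longrightarrow> v \<notin> Y \<Longrightarrow> minor \<Delta> X (insert v Y) = deletion (minor \<Delta> X Y) v"
  unfolding minor_def
  by (simp add: comp_fun_commute_on.fold_insert[OF
        comp_fun_commute_deletion[unfolded comp_fun_commute_def']])

lemma minor_insert_link:
  assumes "finite X" "finite Y" "v \<notin> X" "v \<notin> Y"
  shows "minor \<Delta> (insert v X) Y = link (minor \<Delta> X Y) v"
  using assms(2,4)
proof (induction Y rule: finite_induct)
  case empty
  then show ?case
    using assms(1,3)
    by (simp add: minor_def comp_fun_commute_on.fold_insert[OF
          comp_fun_commute_link[unfolded comp_fun_commute_def']])
next
  case (insert w Y)
  then show ?case
    using link_deletion[of w v "minor \<Delta> X Y"] by (auto simp: minor_insert_deletion)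
qed

lemma spherical_minor:
  assumes "spherical K \<Delta>" "finite X" "finite Y" "X \<inter> Y = {}"
  shows "spherical K (minor \<Delta> X Y)"
proof -
  have "spherical K (minor \<Delta> X {})"
    using assms(2)
    by (induction X rule: finite_induct)
      (simp_all add: minor_empty assms(1) minor_insert_link spherical_link_deletion)
  with assms(3) show ?thesis
    by (induction Y rule: finite_induct) (simp_all add: minor_insert_deletion spherical_link_deletion)
qed

lemma nonacyclic_count_sign:
  assumes "finite B"
  shows "(-1 :: int) ^ nonacyclic_count K \<Delta> B =
    (\<Prod>C\<in>Pow B. acyclicity_sign K (minor \<Delta> C (B - C)))"
proof -
  let ?P = "\<lambda>C. non_acyclic K (minor \<Delta> C (B - C))"
  have degree: "homology_degree K \<Delta> C D \<noteq> None \<longleftrightarrow> non_acyclic K (minor \<Delta> C D)" for C D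
    by (simp add: homology_degree_def non_acyclic_def)
  have "C \<union> D = B \<and> C \<inter> D = {} \<longleftrightarrow> C \<in> Pow B \<and> D = B - C" for C D
    by blast
  then have "{(C, D). C \<union> D = B \<and> C \<inter> D = {} \<and> homology_degree K \<Delta> C D \<noteq> None} =
      (\<lambda>C. (C, B - C)) ` {C \<in> Pow B. ?P C}"
    unfolding degree by (auto simp flip: conj_assoc)
  then have "nonacyclic_count K \<Delta> B = card {C \<in> Pow B. ?P C}"
    unfolding nonacyclic_count_def by (simp add: card_image inj_on_def)
  moreover have "(\<Prod>C\<in>Pow B. acyclicity_sign K (minor \<Delta> C (B - C))) =
      (\<Prod>C\<in>{C \<in> Pow B. ?P C}. -1)"
    unfolding acyclicity_sign_def by (rule prod.inter_filter[symmetric]) (simp add: assms)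
  ultimately show ?thesis
    by simp
qed

text \<open>A subset of \<open>insert v B\<close> is \<open>C\<close> or \<open>insert v C\<close> with \<open>C\<close> a subset of \<open>B\<close>; the two
  corresponding minors are the deletion and the link of \<open>v\<close> in \<open>minor \<Delta> C (B - C)\<close>.\<close>

lemma prod_acyclicity_sign_minors:
  assumes "spherical K \<Delta>" "finite B"
  shows "(\<Prod>C\<in>Pow B. acyclicity_sign K (minor \<Delta> C (B - C))) = acyclicity_sign K \<Delta>"
  using assms(2)
proof (induction B rule: finite_induct)
  case empty
  then show ?case
    by (simp add: minor_empty)
next
  case (insert v B)
  let ?s = "\<lambda>C D. acyclicity_sign K (minor \<Delta> C D)"
  have step: "?s C (insert v B - C) * ?s (insert v C) (insert v B - insert v C) = ?s C (B - C)"
    if "C \<in> Pow B" for C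
  proof -
    have C: "finite C" "finite (B - C)" "v \<notin> C" "v \<notin> B - C"
      using that insert.hyps by (auto intro: finite_subset)
    have "insert v B - C = insert v (B - C)" "insert v B - insert v C = B - C"
      using C insert.hyps(2) by auto
    moreover have "spherical K (minor \<Delta> C (B - C))"
      using C by (intro spherical_minor assms(1)) auto
    ultimately show ?thesis
      using C by (simp add: minor_insert_deletion minor_insert_link acyclicity_sign_mult)
  qed
  have "inj_on (insert v) (Pow B)"
    using insert.hyps(2) by (intro inj_onI) (metis Pow_iff insert_ident subsetD)
  moreover have "Pow B \<inter> insert v ` Pow B = {}"
    using insert.hyps(2) by auto
  ultimately have "(\<Prod>C\<in>Pow (insert v B). ?s C (insert v B - C)) =
      (\<Prod>C\<in>Pow B. ?s C (insert v B - C) * ?s (insert v C) (insert v B - insert v C))"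
    unfolding Pow_insert using insert.hyps(1)
    by (subst prod.union_disjoint) (simp_all add: prod.reindex prod.distrib)
  also have "\<dots> = (\<Prod>C\<in>Pow B. ?s C (B - C))"
    by (intro prod.cong refl step)
  finally show ?case
    using insert.IH by simp
qed

lemma complex_sign_eq:
  assumes "spherical K \<Delta>"
  shows "complex_sign K \<Delta> = acyclicity_sign K \<Delta>"
proof -
  have "finite (vertices \<Delta>)"
    using simplicial_finite_Union[OF spherical_simplicial[OF assms]]
    by (rule finite_subset[rotated]) (auto simp: vertices_def)
  then have "(-1) ^ nonacyclic_count K \<Delta> B = acyclicity_sign K \<Delta>" if "B \<subseteq> vertices \<Delta>" for B
    using nonacyclic_count_sign prod_acyclicity_sign_minors[OF assms] that
    by (metis finite_subset)
  then show ?thesis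
    unfolding complex_sign_def by (intro the_equality) auto
qed

section \<open>Filtrations\<close>

lemma filtration_Cons:
  "filtration K \<Delta> (\<Delta> # Ds) (v # vs) \<longleftrightarrow>
     v \<in> vertices \<Delta> \<and> Ds ! 0 \<in> {deletion \<Delta> v, link \<Delta> v} \<and>
     (\<exists>k. sphere_homology K k (Ds ! 0)) \<and> filtration K (Ds ! 0) Ds vs"
  using deletion_subset[of \<Delta> v] link_subset_deletion[of \<Delta> v]
  by (auto simp: filtration_def All_less_Suc2)

lemma filtration_subset: "filtration K \<Delta> Ds vs \<Longrightarrow> i \<le> length vs \<Longrightarrow> Ds ! i \<subseteq> \<Delta>"
proof (induction i)
  case 0
  then show ?case
    by (simp add: filtration_def)
next
  case (Suc i)
  then have "Ds ! (i + 1) \<subseteq> Ds ! i"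
    unfolding filtration_def by (meson Suc_le_eq)
  with Suc show ?case
    by simp
qed

text \<open>The depth is the cardinality of a set of vertices. It counts the steps to a link because
  the vertices of a filtration are distinct: \<open>v\<close> is not a vertex of any later complex.\<close>

lemma filtration_depth_Cons:
  assumes "filtration K \<Delta> (\<Delta> # Ds) (v # vs)"
  shows "filtration_depth (\<Delta> # Ds) (v # vs) =
    (if Ds ! 0 = link \<Delta> v then 1 else 0) + filtration_depth Ds vs"
proof -
  let ?S = "{vs ! i | i. i < length vs \<and> Ds ! (i + 1) = link (Ds ! i) (vs ! i)}"
  have f: "filtration K (Ds ! 0) Ds vs" "Ds ! 0 \<subseteq> deletion \<Delta> v"
    using assms link_subset_deletion[of \<Delta> v] unfolding filtration_Cons by auto
  have "vs ! i \<noteq> v" if "i < length vs" for i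
  proof -
    have "{vs ! i} \<in> Ds ! i"
      using f(1) that by (auto simp: filtration_def vertices_def)
    then have "{vs ! i} \<in> deletion \<Delta> v"
      using filtration_subset[OF f(1), of i] f(2) that by auto
    then show ?thesis
      by (auto simp: deletion_def)
  qed
  then have "v \<notin> ?S"
    by auto
  moreover have "finite ?S"
    by simp
  moreover have "{(v # vs) ! i | i. i < length (v # vs) \<and>
      (\<Delta> # Ds) ! (i + 1) = link ((\<Delta> # Ds) ! i) ((v # vs) ! i)} =
      (if Ds ! 0 = link \<Delta> v then insert v ?S else ?S)" (is "?T = _")
  proof -
    have "x \<in> ?T \<longleftrightarrow> (\<exists>i<Suc (length vs). x = (v # vs) ! i \<and>
        (\<Delta> # Ds) ! (i + 1) = link ((\<Delta> # Ds) ! i) ((v # vs) ! i))" for x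
      by auto
    then have "x \<in> ?T \<longleftrightarrow> (x = v \<and> Ds ! 0 = link \<Delta> v) \<or> x \<in> ?S" for x
      unfolding Ex_less_Suc2 by auto
    then show ?thesis
      by (auto simp del: mem_Collect_eq)
  qed
  ultimately show ?thesis
    unfolding filtration_depth_def by simp
qed

lemma homology_line_filtration_depth:
  assumes "spherical K \<Delta>" "non_acyclic K \<Delta>" "maximal_filtration K \<Delta> Ds vs"
  shows "homology_line K \<Delta> (int (filtration_depth Ds vs) - 1)"
  using assms
proof (induction vs arbitrary: \<Delta> Ds)
  case Nil
  \<comment> \<open>The only complex is \<open>{{}}\<close>; the degree of its homology is read off from its only face.\<close>
  have "length Ds = 1" "Ds ! 0 = \<Delta>" "last Ds = {{}}"
    using Nil.prems(3) by (simp_all add: maximal_filtration_def filtration_def)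
  then have "Ds = [\<Delta>]" "\<Delta> = {{}}"
    by (cases Ds; simp)+
  moreover obtain k where k: "homology_line K \<Delta> k"
    using Nil.prems(2) by (auto simp: non_acyclic_def)
  moreover obtain \<sigma> where "\<sigma> \<in> \<Delta>" "int (card \<sigma>) = k + 1"
    by (rule homology_line_face[OF k])
  ultimately have "k = -1"
    by simp
  with k \<open>Ds = [\<Delta>]\<close> show ?case
    by (simp add: filtration_depth_def)
next
  case (Cons v vs)
  have "length Ds = length vs + 2" "Ds ! 0 = \<Delta>"
    using Cons.prems(3) by (simp_all add: maximal_filtration_def filtration_def)
  then obtain Ds' where Ds: "Ds = \<Delta> # Ds'" "Ds' \<noteq> []"
    by (cases Ds) fastforce+
  let ?\<Gamma> = "Ds' ! 0"
  have f: "filtration K \<Delta> (\<Delta> # Ds') (v # vs)" "last Ds' = {{}}"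
    using Cons.prems(3) Ds by (auto simp: maximal_filtration_def)
  have \<Gamma>: "?\<Gamma> \<in> {deletion \<Delta> v, link \<Delta> v}" "non_acyclic K ?\<Gamma>" "maximal_filtration K ?\<Gamma> Ds' vs"
    using f unfolding filtration_Cons
    by (auto simp: maximal_filtration_def non_acyclic_def sphere_homology_def)
  note sph = spherical_link_deletion[OF Cons.prems(1), of v]
  note parity = non_acyclic_parity[OF Cons.prems(1), of v]
  have IH: "homology_line K ?\<Gamma> (int (filtration_depth Ds' vs) - 1)"
    using \<Gamma>(1) sph by (intro Cons.IH[OF _ \<Gamma>(2,3)]) auto
  note depth = filtration_depth_Cons[OF f(1)]
  \<comment> \<open>The case split has to follow the definition of the depth, which tests for equality with
    the link.\<close>
  show ?case
  proof (cases "?\<Gamma> = link \<Delta> v")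
    case True
    then have "\<not> non_acyclic K (deletion \<Delta> v)"
      using parity Cons.prems(2) \<Gamma>(2) by auto
    then show ?thesis
      using homology_line_from_link[OF Cons.prems(1)] IH depth True Ds(1) by simp
  next
    case False
    then have "?\<Gamma> = deletion \<Delta> v"
      using \<Gamma>(1) by simp
    then have "\<not> non_acyclic K (link \<Delta> v)"
      using parity Cons.prems(2) \<Gamma>(2) by auto
    then show ?thesis
      using homology_line_from_deletion[OF Cons.prems(1)] IH depth False \<open>?\<Gamma> = deletion \<Delta> v\<close> Ds(1)
      by simp
  qed
qed

lemma maximal_filtration_exists:
  assumes "spherical K \<Delta>" "non_acyclic K \<Delta>"
  shows "\<exists>Ds vs. maximal_filtration K \<Delta> Ds vs"
  using assms
proof (induction rule: spherical.induct)
  case (1 \<Delta>)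
  have sph: "spherical K \<Delta>"
    by (rule spherical.intros) (use "1.hyps" "1.IH" in blast)+
  show ?case
  proof (cases "vertices \<Delta> = {}")
    case True
    have "\<Delta> \<noteq> {}"
      using "1.prems" homology_line_face unfolding non_acyclic_def by blast
    moreover have "\<sigma> = {}" if "\<sigma> \<in> \<Delta>" for \<sigma>
      using True simplicial_subset[OF "1.hyps"(1) that, of "{x}" for x] by (auto simp: vertices_def)
    ultimately have "\<Delta> = {{}}"
      by auto
    then have "maximal_filtration K \<Delta> [\<Delta>] []"
      by (simp add: maximal_filtration_def filtration_def)
    then show ?thesis
      by blast
  next
    case False
    then obtain v where v: "v \<in> vertices \<Delta>"
      by blast
    obtain \<Gamma> where \<Gamma>: "\<Gamma> \<in> {deletion \<Delta> v, link \<Delta> v}" "non_acyclic K \<Gamma>"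
      using non_acyclic_parity[OF sph, of v] "1.prems" by blast
    then obtain Ds vs where Ds: "maximal_filtration K \<Gamma> Ds vs"
      using "1.IH" v by auto
    then have Ds0: "Ds ! 0 = \<Gamma>" "Ds \<noteq> []"
      by (auto simp: maximal_filtration_def filtration_def)
    have "\<exists>k. sphere_homology K k \<Gamma>"
      using \<Gamma> spherical_link_deletion[OF sph, of v] spherical_sphere_homology
      unfolding non_acyclic_def by blast
    then have "maximal_filtration K \<Delta> (\<Delta> # Ds) (v # vs)"
      using Ds Ds0 \<Gamma>(1) v by (auto simp: maximal_filtration_def filtration_Cons)
    then show ?thesis
      by blast
  qed
qed

theorem theorem4p5:
  fixes \<Delta> :: "'a set set"
  assumes "simplicial_complex \<Delta>"
    and "spherical TYPE('k::field) \<Delta>"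
  shows "(acyclic_complex TYPE('k) \<Delta> \<longleftrightarrow> complex_sign TYPE('k) \<Delta> = 1) \<and>
    (complex_sign TYPE('k) \<Delta> = - 1 \<longrightarrow>
      (\<exists>Ds vs. maximal_filtration TYPE('k) \<Delta> Ds vs) \<and>
      (\<forall>Ds vs. maximal_filtration TYPE('k) \<Delta> Ds vs \<longrightarrow>
         sphere_homology TYPE('k) (int (filtration_depth Ds vs) - 1) \<Delta>) \<and>
      (\<forall>Ds vs Ds' vs'.
         maximal_filtration TYPE('k) \<Delta> Ds vs \<and> maximal_filtration TYPE('k) \<Delta> Ds' vs' \<longrightarrow>
         filtration_depth Ds vs = filtration_depth Ds' vs'))"
proof (intro conjI impI allI)
  note sph = assms(2)
  show "acyclic_complex TYPE('k) \<Delta> \<longleftrightarrow> complex_sign TYPE('k) \<Delta> = 1"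
    by (simp add: acyclic_complex_iff[OF sph] complex_sign_eq[OF sph] acyclicity_sign_def)
  assume "complex_sign TYPE('k) \<Delta> = - 1"
  then have na: "non_acyclic TYPE('k) \<Delta>"
    by (simp add: complex_sign_eq[OF sph] acyclicity_sign_def split: if_splits)
  show "\<exists>Ds vs. maximal_filtration TYPE('k) \<Delta> Ds vs"
    by (rule maximal_filtration_exists[OF sph na])
  note line = homology_line_filtration_depth[OF sph na]
  fix Ds vs
  {
    assume "maximal_filtration TYPE('k) \<Delta> Ds vs"
    then show "sphere_homology TYPE('k) (int (filtration_depth Ds vs) - 1) \<Delta>"
      by (intro spherical_sphere_homology[OF sph] line)
  }
  fix Ds' vs'
  assume "maximal_filtration TYPE('k) \<Delta> Ds vs \<and> maximal_filtration TYPE('k) \<Delta> Ds' vs'"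
  then have "int (filtration_depth Ds vs) - 1 = int (filtration_depth Ds' vs') - 1"
    by (intro spherical_line_unique[OF sph] line) simp_all
  then show "filtration_depth Ds vs = filtration_depth Ds' vs'"
    by simp
qed

end
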